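(* Let $X,Y$ be compacta. The set $\mathcal{CA}\mathrm{mb}(X,Y)$ of all ambiguous representations between $X$ and $Y$, ordered by inclusion, is a lattice in which the meet of $R,S$ is $R\cap S$ and the join of $R,S$ is $R\cup S$. The subset $\mathcal{CSA}\mathrm{mb}(X,Y)$ of strict ambiguous representations, the subset $\mathcal{CPA}\mathrm{mb}(X,Y)$ of pseudo-invertible ambiguous representations, and their intersection $\mathcal{CPSA}\mathrm{mb}(X,Y)=\mathcal{CPA}\mathrm{mb}(X,Y)\cap\mathcal{CSA}\mathrm{mb}(X,Y)$ are sublattices of $\mathcal{CA}\mathrm{mb}(X,Y)$.
   Context: A compactum is a compact Hausdorff space. For a compactum $K$, $\exp K$ is the set of all non-empty closed subsets of $K$ with the Vietoris topology (base: $\langle U_1,\dots,U_n\rangle=\{F\in\exp K\mid F\subset U_1\cup\dots\cup U_n,\ F\cap U_i\neq\varnothing\ \forall i\}$, $U_i$ open in $K$). An ambiguous representation between compacta $X$ and $Y$ is a subset $R\subset\exp X\times\exp Y$ such that: (a) if $A'\subset A$, $B\subset B'$ ($A,A'\in\exp X$, $B,B'\in\exp Y$) and $(A,B)\in R$, then $(A',B')\in R$; (b) $(A,Y)\in R$ for all $A\in\exp X$; (c) for all $A\in\exp X$ the set $AR=\{B\in\exp Y\mid(A,B)\in R\}$ is closed in $\exp Y$. It is strict if, in addition, for all $B\in\exp Y$ the set $RB=\{A\in\exp X\mid(A,B)\in R\}$ is closed in $\exp X$. For an ambiguous representation $R\subset\exp X\times\exp Y$, the ambiguous representation $R^{\smile}\subset\exp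 Y\times\exp X$ is defined by: $(\tilde B,\tilde A)\in R^{\smile}$ if and only if for every $A\in\exp X$ with $A\cap\tilde A=\varnothing$ there is $B\in AR$ with $B\cap\tilde B=\varnothing$. An ambiguous representation $R$ is pseudo-invertible if $(R^{\smile})^{\smile}=R$. *)

theory Defs
  imports "HOL-Analysis.Analysis" "HOL-Algebra.Lattice"
begin

definition compactum :: "'a topology \<Rightarrow> bool" where
  "compactum X \<longleftrightarrow> compact_space X \<and> Hausdorff_space X"

definition exps :: "'a topology \<Rightarrow> 'a set set" where
  "exps X = {F. closedin X F \<and> F \<noteq> {}}"

definition vietoris_basic :: "'a topology \<Rightarrow> 'a set set \<Rightarrow> 'a set set" where
  "vietoris_basic X \<U> = {F \<in> exps X. F \<subseteq> \<Union>\<U> \<and> (\<forall>U\<in>\<U>. F \<inter> U \<noteq> {})}"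

definition vietoris_base :: "'a topology \<Rightarrow> 'a set set \<Rightarrow> bool" where
  "vietoris_base X W \<longleftrightarrow>
     (\<exists>\<U>. finite \<U> \<and> (\<forall>U\<in>\<U>. openin X U) \<and> W = vietoris_basic X \<U>)"

definition vietoris :: "'a topology \<Rightarrow> 'a set topology" where
  "vietoris X = topology (arbitrary union_of (vietoris_base X))"

lemma vietoris_base_Int:
  assumes "vietoris_base X V" "vietoris_base X W"
  shows "vietoris_base X (V \<inter> W)"
proof -
  obtain \<U> where U: "finite \<U>" "\<forall>U\<in>\<U>. openin X U" "V = vietoris_basic X \<U>"
    using assms(1) by (auto simp: vietoris_base_def)
  obtain \<W> where W: "finite \<W>" "\<forall>U\<in>\<W>. openin X U" "W = vietoris_basic X \<W>"
    using assms(2) by (auto simp: vietoris_base_def)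
  let ?T = "(\<lambda>U. U \<inter> \<Union>\<W>) ` \<U> \<union> (\<lambda>U. U \<inter> \<Union>\<U>) ` \<W>"
  have "finite ?T" using U W by simp
  moreover have "\<forall>U\<in>?T. openin X U" using U W by auto
  moreover have "V \<inter> W = vietoris_basic X ?T"
  proof (rule Set.set_eqI)
    fix F
    have T: "\<Union>?T = \<Union>\<U> \<inter> \<Union>\<W>" by auto
    show "F \<in> V \<inter> W \<longleftrightarrow> F \<in> vietoris_basic X ?T"
    proof (cases "F \<subseteq> \<Union>\<U> \<and> F \<subseteq> \<Union>\<W>")
      case True
      then have "F \<inter> (U \<inter> \<Union>\<W>) = F \<inter> U" "F \<inter> (U \<inter> \<Union>\<U>) = F \<inter> U" for U
        by auto
      with True show ?thesis
        unfolding U(3) W(3) vietoris_basic_def mem_Collect_eq Int_iff T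
        by (simp add: ball_Un conj_ac)
    next
      case False
      then show ?thesis
        unfolding U(3) W(3) vietoris_basic_def mem_Collect_eq Int_iff T Int_subset_iff
        by (elim Meson.not_conjD[elim_format] disjE) simp_all
    qed
  qed
  ultimately show ?thesis unfolding vietoris_base_def by blast
qed

lemma openin_vietoris: "openin (vietoris X) = arbitrary union_of (vietoris_base X)"
  unfolding vietoris_def
  by (rule topology_inverse') (rule istopology_base, rule vietoris_base_Int)

lemma topspace_vietoris: "topspace (vietoris X) = exps X"
proof
  show "topspace (vietoris X) \<subseteq> exps X"
    by (auto simp: topspace_def openin_vietoris union_of_def vietoris_base_def vietoris_basic_def)
  have "exps X = vietoris_basic X {topspace X}"
    by (auto simp: vietoris_basic_def exps_def dest: closedin_subset)
  then have "vietoris_base X (exps X)"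
    unfolding vietoris_base_def by (intro exI[of _ "{topspace X}"]) auto
  then have "openin (vietoris X) (exps X)"
    by (simp add: openin_vietoris union_of_inc arbitrary_def)
  then show "exps X \<subseteq> topspace (vietoris X)"
    by (rule openin_subset)
qed

definition ambiguous_rep :: "'a topology \<Rightarrow> 'b topology \<Rightarrow> ('a set \<times> 'b set) set \<Rightarrow> bool" where
  "ambiguous_rep X Y R \<longleftrightarrow>
     R \<subseteq> exps X \<times> exps Y \<and>
     (\<forall>A\<in>exps X. \<forall>A'\<in>exps X. \<forall>B\<in>exps Y. \<forall>B'\<in>exps Y.
        A' \<subseteq> A \<and> B \<subseteq> B' \<and> (A, B) \<in> R \<longrightarrow> (A', B') \<in> R) \<and>
     (\<forall>A\<in>exps X. (A, topspace Y) \<in> R) \<and>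
     (\<forall>A\<in>exps X. closedin (vietoris Y) {B \<in> exps Y. (A, B) \<in> R})"

definition strict_ambiguous_rep :: "'a topology \<Rightarrow> 'b topology \<Rightarrow> ('a set \<times> 'b set) set \<Rightarrow> bool" where
  "strict_ambiguous_rep X Y R \<longleftrightarrow>
     ambiguous_rep X Y R \<and>
     (\<forall>B\<in>exps Y. closedin (vietoris X) {A \<in> exps X. (A, B) \<in> R})"

definition pseudo_inverse ::
    "'a topology \<Rightarrow> 'b topology \<Rightarrow> ('a set \<times> 'b set) set \<Rightarrow> ('b set \<times> 'a set) set" where
  "pseudo_inverse X Y R =
     {(B', A'). B' \<in> exps Y \<and> A' \<in> exps X \<and>
        (\<forall>A\<in>exps X. A \<inter> A' = {} \<longrightarrow> (\<exists>B\<in>exps Y. (A, B) \<in> R \<and> B \<inter> B' = {}))}"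

definition pseudo_invertible :: "'a topology \<Rightarrow> 'b topology \<Rightarrow> ('a set \<times> 'b set) set \<Rightarrow> bool" where
  "pseudo_invertible X Y R \<longleftrightarrow>
     ambiguous_rep X Y R \<and> pseudo_inverse Y X (pseudo_inverse X Y R) = R"

definition CAmb :: "'a topology \<Rightarrow> 'b topology \<Rightarrow> ('a set \<times> 'b set) set set" where
  "CAmb X Y = {R. ambiguous_rep X Y R}"

definition CSAmb :: "'a topology \<Rightarrow> 'b topology \<Rightarrow> ('a set \<times> 'b set) set set" where
  "CSAmb X Y = {R. strict_ambiguous_rep X Y R}"

definition CPAmb :: "'a topology \<Rightarrow> 'b topology \<Rightarrow> ('a set \<times> 'b set) set set" where
  "CPAmb X Y = {R. pseudo_invertible X Y R}"

definition CPSAmb :: "'a topology \<Rightarrow> 'b topology \<Rightarrow> ('a set \<times> 'b set) set set" where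
  "CPSAmb X Y = CPAmb X Y \<inter> CSAmb X Y"

definition inclusion_order :: "'a set set \<Rightarrow> 'a set gorder" where
  "inclusion_order \<C> = \<lparr>carrier = \<C>, eq = (=), le = (\<subseteq>)\<rparr>"

text \<open>As for lattices in \<^theory>\<open>HOL-Algebra.Lattice\<close>, non-emptiness is not required. It matters
  only if \<open>Y\<close> is empty and \<open>X\<close> is not: then there is no ambiguous representation at all.\<close>

definition sublattice :: "('a, 'c) gorder_scheme \<Rightarrow> 'a set \<Rightarrow> bool" where
  "sublattice L H \<longleftrightarrow>
     lattice L \<and> H \<subseteq> carrier L \<and>
     (\<forall>x\<in>H. \<forall>y\<in>H. x \<squnion>\<^bsub>L\<^esub> y \<in> H \<and> x \<sqinter>\<^bsub>L\<^esub> y \<in> H)"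

end

(* Passing from R to its double pseudo-inverse never adds pairs: (A, B) lies in the double
   pseudo-inverse iff each open V containing B, V different from Y, admits an open U containing A,
   U different from X, such that every non-empty closed subset of U is R-related to a closed
   subset of V; since AR is closed and upward closed, this forces (A, B) into R. Hence
   pseudo-invertibility only requires R to be contained in its double pseudo-inverse. This
   inclusion passes to unions because pseudo-inversion is monotone, and to intersections because
   pseudo-inversion commutes with the intersection of relations that are upward closed in the
   second argument (take the union of the two witnesses). *)

theory Submission
  imports Defs
begin

section \<open>Closure of ambiguous and strict representations under intersection and union\<close>

lemma exps_Un: "A \<in> exps X \<Longrightarrow> B \<in> exps X \<Longrightarrow> A \<union> B \<in> exps X"
  by (auto simp: exps_def)

text \<open>In \<open>ambiguous_rep_mono\<close> the old pair lies in the hyperspaces because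
  \<open>R\<close> does, so only the new sets \<open>A'\<close> and \<open>B'\<close> carry a
  membership premise.\<close>

lemma ambiguous_repD:
  assumes "ambiguous_rep X Y R"
  shows ambiguous_rep_subset: "R \<subseteq> exps X \<times> exps Y"
    and ambiguous_rep_mono:
      "\<And>A A' B B'. \<lbrakk>(A, B) \<in> R; A' \<in> exps X; B' \<in> exps Y; A' \<subseteq> A; B \<subseteq> B'\<rbrakk> \<Longrightarrow> (A', B') \<in> R"
    and ambiguous_rep_topspace: "\<And>A. A \<in> exps X \<Longrightarrow> (A, topspace Y) \<in> R"
    and ambiguous_rep_closed:
      "\<And>A. A \<in> exps X \<Longrightarrow> closedin (vietoris Y) {B \<in> exps Y. (A, B) \<in> R}"
proof -
  show sub: "R \<subseteq> exps X \<times> exps Y"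
    using assms by (simp add: ambiguous_rep_def)
  fix A A' B B'
  assume "(A, B) \<in> R" "A' \<in> exps X" "B' \<in> exps Y" "A' \<subseteq> A" "B \<subseteq> B'"
  moreover from this sub have "A \<in> exps X" "B \<in> exps Y" by auto
  ultimately show "(A', B') \<in> R"
    using assms unfolding ambiguous_rep_def by blast
qed (use assms in \<open>simp_all add: ambiguous_rep_def\<close>)

lemma ambiguous_rep_Int:
  assumes R: "ambiguous_rep X Y R" and S: "ambiguous_rep X Y S"
  shows "ambiguous_rep X Y (R \<inter> S)"
proof -
  have "{B \<in> exps Y. (A, B) \<in> R \<inter> S} = {B \<in> exps Y. (A, B) \<in> R} \<inter> {B \<in> exps Y. (A, B) \<in> S}"
    for A by auto
  then have "closedin (vietoris Y) {B \<in> exps Y. (A, B) \<in> R \<inter> S}" if "A \<in> exps X" for A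
    using ambiguous_rep_closed[OF R that] ambiguous_rep_closed[OF S that] by (simp add: closedin_Int)
  moreover have "R \<inter> S \<subseteq> exps X \<times> exps Y"
    using ambiguous_rep_subset[OF R] ambiguous_rep_subset[OF S] by blast
  moreover have "(A, topspace Y) \<in> R \<inter> S" if "A \<in> exps X" for A
    using ambiguous_rep_topspace[OF R that] ambiguous_rep_topspace[OF S that] by blast
  moreover have "(A', B') \<in> R \<inter> S"
    if "A' \<in> exps X" "B' \<in> exps Y" "A' \<subseteq> A" "B \<subseteq> B'" "(A, B) \<in> R \<inter> S" for A A' B B'
    using ambiguous_rep_mono[OF R _ that(1-4)] ambiguous_rep_mono[OF S _ that(1-4)] that(5) by blast
  ultimately show ?thesis
    unfolding ambiguous_rep_def by blast
qed

text \<open>The monotonicity law starts from a single pair, so it survives unions; the section at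
  \<open>A\<close> is a union of two closed sections.\<close>

lemma ambiguous_rep_Un:
  assumes R: "ambiguous_rep X Y R" and S: "ambiguous_rep X Y S"
  shows "ambiguous_rep X Y (R \<union> S)"
proof -
  have "{B \<in> exps Y. (A, B) \<in> R \<union> S} = {B \<in> exps Y. (A, B) \<in> R} \<union> {B \<in> exps Y. (A, B) \<in> S}"
    for A by auto
  then have "closedin (vietoris Y) {B \<in> exps Y. (A, B) \<in> R \<union> S}" if "A \<in> exps X" for A
    using ambiguous_rep_closed[OF R that] ambiguous_rep_closed[OF S that] by (simp add: closedin_Un)
  moreover have "R \<union> S \<subseteq> exps X \<times> exps Y"
    using ambiguous_rep_subset[OF R] ambiguous_rep_subset[OF S] by blast
  moreover have "(A, topspace Y) \<in> R \<union> S" if "A \<in> exps X" for A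
    using ambiguous_rep_topspace[OF R that] ambiguous_rep_topspace[OF S that] by blast
  moreover have "(A', B') \<in> R \<union> S"
    if "A' \<in> exps X" "B' \<in> exps Y" "A' \<subseteq> A" "B \<subseteq> B'" "(A, B) \<in> R \<union> S" for A A' B B'
    using ambiguous_rep_mono[OF R _ that(1-4)] ambiguous_rep_mono[OF S _ that(1-4)] that(5) by blast
  ultimately show ?thesis
    unfolding ambiguous_rep_def by blast
qed

lemma strict_ambiguous_rep_Int:
  assumes "strict_ambiguous_rep X Y R" "strict_ambiguous_rep X Y S"
  shows "strict_ambiguous_rep X Y (R \<inter> S)"
proof -
  have "{A \<in> exps X. (A, B) \<in> R \<inter> S} = {A \<in> exps X. (A, B) \<in> R} \<inter> {A \<in> exps X. (A, B) \<in> S}"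
    for B by auto
  with assms show ?thesis
    by (simp add: strict_ambiguous_rep_def ambiguous_rep_Int closedin_Int)
qed

lemma strict_ambiguous_rep_Un:
  assumes "strict_ambiguous_rep X Y R" "strict_ambiguous_rep X Y S"
  shows "strict_ambiguous_rep X Y (R \<union> S)"
proof -
  have "{A \<in> exps X. (A, B) \<in> R \<union> S} = {A \<in> exps X. (A, B) \<in> R} \<union> {A \<in> exps X. (A, B) \<in> S}"
    for B by auto
  with assms show ?thesis
    by (simp add: strict_ambiguous_rep_def ambiguous_rep_Un closedin_Un)
qed

section \<open>Pseudo-inversion and pseudo-invertibility\<close>

lemma pseudo_inverse_subset_mono: "R \<subseteq> S \<Longrightarrow> pseudo_inverse X Y R \<subseteq> pseudo_inverse X Y S"
  unfolding pseudo_inverse_def by blast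

text \<open>Enlarging \<open>A\<close> leaves fewer sets disjoint from it, hence fewer conditions to
  meet. This allows \<open>pseudo_inverse_Int\<close> to be applied to the pseudo-inverses
  themselves.\<close>

lemma pseudo_inverse_upward:
  assumes "(B, A) \<in> pseudo_inverse X Y R" "A' \<in> exps X" "A \<subseteq> A'"
  shows "(B, A') \<in> pseudo_inverse X Y R"
proof -
  have "C \<inter> A = {}" if "C \<inter> A' = {}" for C
    using that assms(3) by blast
  with assms show ?thesis
    unfolding pseudo_inverse_def by simp
qed

text \<open>Stated for relations that are upward closed in the second argument, so that it covers
  both ambiguous representations and their pseudo-inverses.\<close>

lemma pseudo_inverse_Int:
  assumes R: "\<And>A B B'. \<lbrakk>(A, B) \<in> R; B' \<in> exps Y; B \<subseteq> B'\<rbrakk> \<Longrightarrow> (A, B') \<in> R"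
    and S: "\<And>A B B'. \<lbrakk>(A, B) \<in> S; B' \<in> exps Y; B \<subseteq> B'\<rbrakk> \<Longrightarrow> (A, B') \<in> S"
  shows "pseudo_inverse X Y (R \<inter> S) = pseudo_inverse X Y R \<inter> pseudo_inverse X Y S"
proof
  show "pseudo_inverse X Y (R \<inter> S) \<subseteq> pseudo_inverse X Y R \<inter> pseudo_inverse X Y S"
    by (simp add: pseudo_inverse_subset_mono)
  show "pseudo_inverse X Y R \<inter> pseudo_inverse X Y S \<subseteq> pseudo_inverse X Y (R \<inter> S)"
  proof clarify
    fix B' A'
    assume r: "(B', A') \<in> pseudo_inverse X Y R" and s: "(B', A') \<in> pseudo_inverse X Y S"
    have "\<exists>B\<in>exps Y. (A, B) \<in> R \<inter> S \<and> B \<inter> B' = {}" if "A \<in> exps X" "A \<inter> A' = {}" for A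
    proof -
      obtain B1 where B1: "B1 \<in> exps Y" "(A, B1) \<in> R" "B1 \<inter> B' = {}"
        using r \<open>A \<in> exps X\<close> \<open>A \<inter> A' = {}\<close> by (auto simp: pseudo_inverse_def)
      obtain B2 where B2: "B2 \<in> exps Y" "(A, B2) \<in> S" "B2 \<inter> B' = {}"
        using s \<open>A \<in> exps X\<close> \<open>A \<inter> A' = {}\<close> by (auto simp: pseudo_inverse_def)
      have U: "B1 \<union> B2 \<in> exps Y"
        using B1 B2 by (simp add: exps_Un)
      have "(A, B1 \<union> B2) \<in> R \<inter> S"
        using R[OF B1(2) U] S[OF B2(2) U] by simp
      with U B1 B2 show ?thesis
        by blast
    qed
    with r show "(B', A') \<in> pseudo_inverse X Y (R \<inter> S)"
      by (simp add: pseudo_inverse_def)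
  qed
qed

text \<open>The section of \<open>R\<close> at \<open>A\<close> is a Vietoris-closed up-set, so it
  is closed even in the coarser topology whose basic neighbourhoods of \<open>B\<close> are given by
  \<open>B' \<subseteq> V\<close> alone.\<close>

lemma ambiguous_rep_limit:
  assumes R: "ambiguous_rep X Y R" and A: "A \<in> exps X" and B: "B \<in> exps Y"
    and nbhd: "\<And>V. \<lbrakk>openin Y V; B \<subseteq> V\<rbrakk> \<Longrightarrow> \<exists>B'\<in>exps Y. B' \<subseteq> V \<and> (A, B') \<in> R"
  shows "(A, B) \<in> R"
proof (rule ccontr)
  assume "(A, B) \<notin> R"
  have "openin (vietoris Y) (exps Y - {B \<in> exps Y. (A, B) \<in> R})"
    using ambiguous_rep_closed[OF R A] by (simp add: closedin_def topspace_vietoris)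
  moreover have "B \<in> exps Y - {B \<in> exps Y. (A, B) \<in> R}"
    using B \<open>(A, B) \<notin> R\<close> by simp
  ultimately obtain W where W: "vietoris_base Y W" "B \<in> W"
    "W \<subseteq> exps Y - {B \<in> exps Y. (A, B) \<in> R}"
    unfolding openin_vietoris arbitrary_union_of_alt by blast
  then obtain \<U> where \<U>: "\<forall>U\<in>\<U>. openin Y U" "W = vietoris_basic Y \<U>"
    by (auto simp: vietoris_base_def)
  have BU: "B \<subseteq> \<Union>\<U>" "\<forall>U\<in>\<U>. B \<inter> U \<noteq> {}"
    using W(2) \<U>(2) by (auto simp: vietoris_basic_def)
  then obtain B' where B': "B' \<in> exps Y" "B' \<subseteq> \<Union>\<U>" "(A, B') \<in> R"
    using nbhd[of "\<Union>\<U>"] \<U>(1) by blast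
  \<comment> \<open>\<open>B'\<close> itself may miss members of \<open>\<U>\<close>, but enlarging it by \<open>B\<close> keeps it in \<open>AR\<close>.\<close>
  have U: "B' \<union> B \<in> exps Y"
    using B B' by (simp add: exps_Un)
  have "B' \<union> B \<in> W"
    using U BU B' unfolding \<U>(2) vietoris_basic_def by blast
  moreover have "(A, B' \<union> B) \<in> R"
    using ambiguous_rep_mono[OF R B'(3) A U] by simp
  ultimately show False
    using W(3) U by blast
qed

lemma pseudo_inverse_pseudo_inverse_subset:
  assumes R: "ambiguous_rep X Y R"
  shows "pseudo_inverse Y X (pseudo_inverse X Y R) \<subseteq> R"
proof clarify
  fix A B
  assume AB: "(A, B) \<in> pseudo_inverse Y X (pseudo_inverse X Y R)"
  then have A: "A \<in> exps X" and B: "B \<in> exps Y"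
    by (auto simp: pseudo_inverse_def)
  show "(A, B) \<in> R"
  proof (rule ambiguous_rep_limit[OF R A B])
    fix V
    assume V: "openin Y V" "B \<subseteq> V"
    show "\<exists>B'\<in>exps Y. B' \<subseteq> V \<and> (A, B') \<in> R"
    \<comment> \<open>An empty complement is not a point of \<open>exps Y\<close> and cannot serve
      as a test set; then \<open>V\<close> covers \<open>Y\<close>, and \<open>topspace Y\<close>
      itself is the witness.\<close>
    proof (cases "topspace Y - V = {}")
      case True
      then have "topspace Y \<in> exps Y" "topspace Y \<subseteq> V"
        using B closedin_subset by (fastforce simp: exps_def)+
      with ambiguous_rep_topspace[OF R A] show ?thesis
        by blast
    next
      case False
      \<comment> \<open>The complement of \<open>V\<close> tests the outer pseudo-inverse and yields
        \<open>A'\<close> disjoint from \<open>A\<close>; then \<open>A\<close> tests the inner one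
        and yields a \<open>B'\<close> that avoids the complement.\<close>
      with V have "topspace Y - V \<in> exps Y" "(topspace Y - V) \<inter> B = {}"
        by (auto simp: exps_def)
      with AB obtain A' where "(topspace Y - V, A') \<in> pseudo_inverse X Y R" "A' \<inter> A = {}"
        unfolding pseudo_inverse_def by blast
      with A obtain B' where B': "B' \<in> exps Y" "(A, B') \<in> R" "B' \<inter> (topspace Y - V) = {}"
        unfolding pseudo_inverse_def by blast
      moreover have "B' \<subseteq> topspace Y"
        using B'(1) closedin_subset by (auto simp: exps_def)
      ultimately show ?thesis
        by blast
    qed
  qed
qed

text \<open>Serves the union case, where monotonicity supplies an inclusion only.\<close>

lemma pseudo_invertible_iff:
  "pseudo_invertible X Y R \<longleftrightarrow>
    ambiguous_rep X Y R \<and> R \<subseteq> pseudo_inverse Y X (pseudo_inverse X Y R)"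
  using pseudo_inverse_pseudo_inverse_subset unfolding pseudo_invertible_def by blast

lemma pseudo_invertible_Un:
  assumes "pseudo_invertible X Y R" "pseudo_invertible X Y S"
  shows "pseudo_invertible X Y (R \<union> S)"
proof -
  have "pseudo_inverse Y X (pseudo_inverse X Y T) \<subseteq>
      pseudo_inverse Y X (pseudo_inverse X Y (R \<union> S))" if "T \<subseteq> R \<union> S" for T
    using that by (intro pseudo_inverse_subset_mono)
  from this[of R] this[of S] assms show ?thesis
    unfolding pseudo_invertible_iff using ambiguous_rep_Un by blast
qed

text \<open>Pseudo-inversion commutes with the intersection at both stages, so the required equality
  is obtained directly.\<close>

lemma pseudo_invertible_Int:
  assumes "pseudo_invertible X Y R" "pseudo_invertible X Y S"
  shows "pseudo_invertible X Y (R \<inter> S)"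
proof -
  have R: "ambiguous_rep X Y R" and S: "ambiguous_rep X Y S"
    using assms by (auto simp: pseudo_invertible_def)
  \<comment> \<open>Monotonicity with the first component kept fixed, as
    \<open>pseudo_inverse_Int\<close> expects it.\<close>
  have up: "(A, B') \<in> T" if "ambiguous_rep X Y T" "(A, B) \<in> T" "B' \<in> exps Y" "B \<subseteq> B'" for T A B B'
    using ambiguous_rep_mono[OF that(1,2) _ that(3) _ that(4)] ambiguous_rep_subset[OF that(1)] that(2)
    by blast
  have "pseudo_inverse X Y (R \<inter> S) = pseudo_inverse X Y R \<inter> pseudo_inverse X Y S"
    by (rule pseudo_inverse_Int) (erule (2) up[OF R] up[OF S])+
  moreover have "pseudo_inverse Y X (pseudo_inverse X Y R \<inter> pseudo_inverse X Y S) =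
      pseudo_inverse Y X (pseudo_inverse X Y R) \<inter> pseudo_inverse Y X (pseudo_inverse X Y S)"
    by (rule pseudo_inverse_Int) (erule (2) pseudo_inverse_upward)+
  ultimately show ?thesis
    using assms ambiguous_rep_Int[OF R S] by (simp add: pseudo_invertible_def)
qed

section \<open>Lattices of sets ordered by inclusion\<close>

lemma partial_order_inclusion_order: "partial_order (inclusion_order \<C>)"
  by unfold_locales (auto simp: inclusion_order_def)

lemma is_lub_inclusion_order:
  assumes "R \<in> \<C>" "S \<in> \<C>" "R \<union> S \<in> \<C>"
  shows "is_lub (inclusion_order \<C>) (R \<union> S) {R, S}"
  using assms by (auto simp: least_def Upper_def inclusion_order_def)

lemma is_glb_inclusion_order:
  assumes "R \<in> \<C>" "S \<in> \<C>" "R \<inter> S \<in> \<C>"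
  shows "is_glb (inclusion_order \<C>) (R \<inter> S) {R, S}"
  using assms by (auto simp: greatest_def Lower_def inclusion_order_def)

lemma join_inclusion_order:
  assumes "R \<in> \<C>" "S \<in> \<C>" "R \<union> S \<in> \<C>"
  shows "R \<squnion>\<^bsub>inclusion_order \<C>\<^esub> S = R \<union> S"
  \<comment> \<open>The join is a Hilbert choice among least upper bounds; antisymmetry makes the
    candidate \<open>R \<union> S\<close> the only one.\<close>
  unfolding join_def sup_def
  by (rule some_equality, rule is_lub_inclusion_order[OF assms])
    (rule partial_order.least_unique[OF partial_order_inclusion_order _ is_lub_inclusion_order[OF assms]])

lemma meet_inclusion_order:
  assumes "R \<in> \<C>" "S \<in> \<C>" "R \<inter> S \<in> \<C>"
  shows "R \<sqinter>\<^bsub>inclusion_order \<C>\<^esub> S = R \<inter> S"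
  unfolding meet_def inf_def
  by (rule some_equality, rule is_glb_inclusion_order[OF assms])
    (rule partial_order.greatest_unique[OF partial_order_inclusion_order _ is_glb_inclusion_order[OF assms]])

lemma lattice_inclusion_order:
  assumes "\<And>R S. \<lbrakk>R \<in> \<C>; S \<in> \<C>\<rbrakk> \<Longrightarrow> R \<union> S \<in> \<C>" "\<And>R S. \<lbrakk>R \<in> \<C>; S \<in> \<C>\<rbrakk> \<Longrightarrow> R \<inter> S \<in> \<C>"
  shows "lattice (inclusion_order \<C>)"
proof -
  interpret partial_order "inclusion_order \<C>"
    by (rule partial_order_inclusion_order)
  have carrier: "carrier (inclusion_order \<C>) = \<C>"
    by (simp add: inclusion_order_def)
  show ?thesis
  proof unfold_locales
    fix R S
    assume "R \<in> carrier (inclusion_order \<C>)" "S \<in> carrier (inclusion_order \<C>)"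
    then have RS: "R \<in> \<C>" "S \<in> \<C>"
      unfolding carrier .
    show "\<exists>U. is_lub (inclusion_order \<C>) U {R, S}"
      using is_lub_inclusion_order[OF RS assms(1)[OF RS]] by (rule exI)
    show "\<exists>I. is_glb (inclusion_order \<C>) I {R, S}"
      using is_glb_inclusion_order[OF RS assms(2)[OF RS]] by (rule exI)
  qed
qed

text \<open>\<open>sublattice\<close> refers to the operations of the ambient order; closure of
  \<open>\<C>\<close> identifies them with union and intersection, so closure of \<open>\<D>\<close>
  under these suffices.\<close>

lemma sublattice_inclusion_order:
  assumes \<C>: "\<And>R S. \<lbrakk>R \<in> \<C>; S \<in> \<C>\<rbrakk> \<Longrightarrow> R \<union> S \<in> \<C>" "\<And>R S. \<lbrakk>R \<in> \<C>; S \<in> \<C>\<rbrakk> \<Longrightarrow> R \<inter> S \<in> \<C>"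
    and "\<D> \<subseteq> \<C>"
    and "\<And>R S. \<lbrakk>R \<in> \<D>; S \<in> \<D>\<rbrakk> \<Longrightarrow> R \<union> S \<in> \<D>" "\<And>R S. \<lbrakk>R \<in> \<D>; S \<in> \<D>\<rbrakk> \<Longrightarrow> R \<inter> S \<in> \<D>"
  shows "sublattice (inclusion_order \<C>) \<D>"
proof -
  have "carrier (inclusion_order \<C>) = \<C>"
    by (simp add: inclusion_order_def)
  with assms show ?thesis
    unfolding sublattice_def
    by (auto simp: lattice_inclusion_order subset_iff join_inclusion_order meet_inclusion_order)
qed

theorem mainTheorem3:
  fixes X :: "'a topology" and Y :: "'b topology"
  assumes "compactum X" and "compactum Y"
  shows "lattice (inclusion_order (CAmb X Y)) \<and>
    (\<forall>R\<in>CAmb X Y. \<forall>S\<in>CAmb X Y.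
       R \<sqinter>\<^bsub>inclusion_order (CAmb X Y)\<^esub> S = R \<inter> S \<and>
       R \<squnion>\<^bsub>inclusion_order (CAmb X Y)\<^esub> S = R \<union> S) \<and>
    sublattice (inclusion_order (CAmb X Y)) (CSAmb X Y) \<and>
    sublattice (inclusion_order (CAmb X Y)) (CPAmb X Y) \<and>
    sublattice (inclusion_order (CAmb X Y)) (CPSAmb X Y)"
proof -
  have Un: "R \<union> S \<in> CAmb X Y" and Int: "R \<inter> S \<in> CAmb X Y"
    if "R \<in> CAmb X Y" "S \<in> CAmb X Y" for R S
    using that by (auto simp: CAmb_def ambiguous_rep_Un ambiguous_rep_Int)
  have "sublattice (inclusion_order (CAmb X Y)) (CSAmb X Y)"
    by (rule sublattice_inclusion_order[OF Un Int])
      \<comment> \<open>Closure is settled while strictness is still folded, as the closure lemmas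
        are stated for the predicate; the second \<open>auto\<close> unfolds it for the inclusion in
        \<open>CAmb X Y\<close>.\<close>
      (auto simp: CSAmb_def strict_ambiguous_rep_Un strict_ambiguous_rep_Int,
       auto simp: CAmb_def strict_ambiguous_rep_def)
  moreover have "sublattice (inclusion_order (CAmb X Y)) (CPAmb X Y)"
    by (rule sublattice_inclusion_order[OF Un Int])
      (auto simp: CPAmb_def pseudo_invertible_Un pseudo_invertible_Int,
       auto simp: CAmb_def pseudo_invertible_def)
  moreover have "sublattice (inclusion_order (CAmb X Y)) (CPSAmb X Y)"
    by (rule sublattice_inclusion_order[OF Un Int])
      (auto simp: CPSAmb_def CSAmb_def CPAmb_def strict_ambiguous_rep_Un strict_ambiguous_rep_Int
        pseudo_invertible_Un pseudo_invertible_Int,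
       auto simp: CAmb_def strict_ambiguous_rep_def)
  ultimately show ?thesis
    by (simp add: lattice_inclusion_order meet_inclusion_order join_inclusion_order Un Int)
qed

end
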